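(* Let $n\ge1$, let $\mathcal{E}$ be a Hilbert space, let $L\in\mathcal{B}(\mathcal{E},\mathcal{F}_n^2\otimes\mathcal{E})$, let $W_L$ be an isometric odometer map, and suppose that $\dim(\mathcal{E}_L\ominus L\mathcal{E})<\infty$. Then, for every $\lambda\in\mathbb{D}$, the operator $W_L-\lambda I$ is Fredholm and $$\operatorname{ind}(W_L-\lambda I)=-\dim\ker W_L^*=-\dim(\mathcal{E}_L\ominus L\mathcal{E}).$$ If, in addition, $W_L$ is not unitary, then $\sigma_{\mathrm{ess}}(W_L)=\mathbb{T}$.
   Context: Hilbert spaces are separable and complex; $\mathcal{B}(\mathcal{H},\mathcal{K})$ denotes bounded linear operators; $\mathbb{D}$ is the open unit disc and $\mathbb{T}$ the unit circle. $F_n^+$ is the free monoid of words $\mu=\mu_1\cdots\mu_m$ in the letters $1,\dots,n$, with empty word $\emptyset$. The full Fock space $\mathcal{F}_n^2=\mathbb{C}\Omega\oplus\bigoplus_{k\ge1}(\mathbb{C}^n)^{\otimes k}$ has orthonormal basis $e_\mu=e_{\mu_1}\otimes\cdots\otimes e_{\mu_m}$, $\mu\in F_n^+$, with $e_\emptyset=\Omega$; $e_k^m:=e_k^{\otimes m}$, $e_k^0=\Omega$, and $\Omega$ acts as a unit for left tensoring. For $f\in\mathcal{F}_n^2\otimes\mathcal{E}$, $e_1^p\otimes f$ means left tensoring by $e_1^p$. Odometer map: for $L\in\mathcal{B}(\mathcal{E},\mathcal{F}_n^2\otimes\mathcal{E})$, $W_L$ is the operator on $\mathcal{F}_n^2\otimes\mathcal{E}$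 given by $W_L(\Omega\otimes\eta)=L\eta$; $W_L(e_n^m\otimes\eta)=e_1^m\otimes L\eta$ for $m\ge1$; and, for a nonempty word $\mu=\mu_1\cdots\mu_m$ having some letter $\ne n$, with $k$ the smallest index such that $\mu_k\neq n$, $W_L(e_\mu\otimes\eta)=e_1^{k-1}\otimes e_{\mu_k+1}\otimes e_{\mu_{k+1}}\otimes\cdots\otimes e_{\mu_m}\otimes\eta$. "Isometric odometer map" means $W_L$ is a (bounded, everywhere defined) isometry. $\mathcal{E}_L:=\overline{\mathrm{span}}\{e_1^m\otimes\eta:m\ge0,\eta\in\mathcal{E}\}\ominus\overline{\mathrm{span}}\{e_1^p\otimes L\zeta:p\ge1,\zeta\in\mathcal{E}\}$, where $\mathcal{A}\ominus\mathcal{B}$ means $\mathcal{A}\cap\mathcal{B}^\perp$. A bounded operator $T$ is Fredholm if $\dim\ker T<\infty$, $\mathrm{ran}\,T$ is closed and $\dim\ker T^*<\infty$; then $\operatorname{ind}(T)=\dim\ker T-\dim\ker T^*$. $\sigma_{\mathrm{ess}}(T)=\{\lambda\in\mathbb{C}:T-\lambda I\text{ is not Fredholm}\}$. *)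

theory Defs
  imports "HOL-Analysis.Analysis"
begin

text \<open>A complex inner product space carries its underlying real inner product space structure
  (hence the library's norm and topology); the inner product is linear in the first argument.\<close>

class complex_inner = real_inner +
  fixes scaleC :: "complex \<Rightarrow> 'a \<Rightarrow> 'a"  (infixr \<open>*\<^sub>C\<close> 75)
    and cinner :: "'a \<Rightarrow> 'a \<Rightarrow> complex"
  assumes scaleC_add_right: "c *\<^sub>C (x + y) = c *\<^sub>C x + c *\<^sub>C y"
    and scaleC_add_left: "(c + d) *\<^sub>C x = c *\<^sub>C x + d *\<^sub>C x"
    and scaleC_scaleC: "c *\<^sub>C d *\<^sub>C x = (c * d) *\<^sub>C x"
    and scaleR_scaleC: "r *\<^sub>R x = complex_of_real r *\<^sub>C x"
    and cinner_commute: "cinner x y = cnj (cinner y x)"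
    and cinner_add_left: "cinner (x + y) z = cinner x z + cinner y z"
    and cinner_scaleC_left: "cinner (c *\<^sub>C x) y = c * cinner x y"
    and inner_eq_Re_cinner: "inner x y = Re (cinner x y)"

class complex_hilbert = complex_inner + complete_space

lemma scaleC_one: "1 *\<^sub>C (x::'a::complex_inner) = x"
  using scaleR_scaleC[of 1 x] by simp

global_interpretation complex_vector: vector_space "scaleC :: complex \<Rightarrow> 'a \<Rightarrow> 'a::complex_inner"
  defines cspan = complex_vector.span
    and cdim = complex_vector.dim
  by unfold_locales (simp_all add: scaleC_add_right scaleC_add_left scaleC_scaleC scaleC_one)

lemma cinner_self: "cinner x x = complex_of_real ((norm (x::'a::complex_inner))\<^sup>2)"
  using cinner_commute[of x x] inner_eq_Re_cinner[of x x]
  by (simp add: complex_eq_iff power2_norm_eq_inner)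

lemma cinner_add_right: "cinner x (y + z) = cinner x y + cinner x (z::'a::complex_inner)"
  by (metis cinner_add_left cinner_commute complex_cnj_add)

lemma cinner_scaleC_right: "cinner x (c *\<^sub>C y) = cnj c * cinner x (y::'a::complex_inner)"
  by (metis cinner_scaleC_left cinner_commute complex_cnj_mult)

lemma norm_scaleC: "norm (c *\<^sub>C (x::'a::complex_inner)) = cmod c * norm x"
proof -
  have "cinner (c *\<^sub>C x) (c *\<^sub>C x) = (c * cnj c) * cinner x x"
    by (simp add: cinner_scaleC_left cinner_scaleC_right)
  then have "complex_of_real ((norm (c *\<^sub>C x))\<^sup>2) = complex_of_real ((cmod c * norm x)\<^sup>2)"
    unfolding cinner_self complex_norm_square[symmetric]
    by (simp only: power_mult_distrib of_real_mult of_real_power)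
  then have "(norm (c *\<^sub>C x))\<^sup>2 = (cmod c * norm x)\<^sup>2"
    by (simp only: of_real_eq_iff)
  then show ?thesis
    by (rule power2_eq_imp_eq) auto
qed

lemma norm_cinner_le: "cmod (cinner x y) \<le> norm x * norm (y::'a::complex_inner)"
proof (cases "cinner x y = 0")
  case False
  define u where "u = cnj (cinner x y) / cmod (cinner x y)"
  have u: "cmod u = 1"
    using False by (simp add: u_def norm_divide)
  have "cinner (u *\<^sub>C x) y = cmod (cinner x y)"
    using False complex_norm_square[of "cinner x y"]
    by (simp add: u_def cinner_scaleC_left power2_eq_square divide_eq_eq mult.commute)
  then have "cmod (cinner x y) = inner (u *\<^sub>C x) y"
    by (simp add: inner_eq_Re_cinner)
  also have "\<dots> \<le> norm (u *\<^sub>C x) * norm y"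
    by (rule norm_cauchy_schwarz)
  finally show ?thesis
    by (simp add: norm_scaleC u)
qed simp

text \<open>\<^term>\<open>cdim V\<close> is a natural number, equal to \<open>0\<close> if \<open>V\<close> is infinite-dimensional; hence the
  separate finiteness predicate.\<close>

definition findim :: "'a::complex_inner set \<Rightarrow> bool"
  where "findim V \<longleftrightarrow> (\<exists>B. finite B \<and> V \<subseteq> cspan B)"

definition ortho_minus :: "'a::complex_inner set \<Rightarrow> 'a set \<Rightarrow> 'a set"  (infixl \<open>\<ominus>\<close> 65)
  where "A \<ominus> B = {x \<in> A. \<forall>y \<in> B. cinner x y = 0}"

definition bounded_clinear :: "('a::complex_inner \<Rightarrow> 'b::complex_inner) \<Rightarrow> bool"
  where "bounded_clinear T \<longleftrightarrow> bounded_linear T \<and> (\<forall>c x. T (c *\<^sub>C x) = c *\<^sub>C T x)"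

text \<open>For bounded operators the description is proper by the Riesz representation theorem.\<close>

definition hilbert_adjoint :: "('a::complex_hilbert \<Rightarrow> 'b::complex_hilbert) \<Rightarrow> 'b \<Rightarrow> 'a"
  where "hilbert_adjoint T = (THE S. \<forall>x y. cinner (T x) y = cinner x (S y))"

definition op_kernel :: "('a::complex_inner \<Rightarrow> 'b::complex_inner) \<Rightarrow> 'a set"
  where "op_kernel T = {x. T x = 0}"

definition isometric :: "('a::complex_inner \<Rightarrow> 'b::complex_inner) \<Rightarrow> bool"
  where "isometric T \<longleftrightarrow> bounded_clinear T \<and> (\<forall>x. norm (T x) = norm x)"

definition unitary :: "('a::complex_hilbert \<Rightarrow> 'a) \<Rightarrow> bool"
  where "unitary T \<longleftrightarrow> bounded_clinear T \<and> hilbert_adjoint T \<circ> T = id \<and> T \<circ> hilbert_adjoint T = id"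

definition fredholm :: "('a::complex_hilbert \<Rightarrow> 'a) \<Rightarrow> bool"
  where "fredholm T \<longleftrightarrow> bounded_clinear T \<and> findim (op_kernel T) \<and> closed (range T) \<and>
    findim (op_kernel (hilbert_adjoint T))"

definition fredholm_index :: "('a::complex_hilbert \<Rightarrow> 'a) \<Rightarrow> int"
  where "fredholm_index T = int (cdim (op_kernel T)) - int (cdim (op_kernel (hilbert_adjoint T)))"

definition op_minus_scalar :: "('a::complex_inner \<Rightarrow> 'a) \<Rightarrow> complex \<Rightarrow> 'a \<Rightarrow> 'a"
  where "op_minus_scalar T c = (\<lambda>x. T x - c *\<^sub>C x)"

definition essential_spectrum :: "('a::complex_hilbert \<Rightarrow> 'a) \<Rightarrow> complex set"
  where "essential_spectrum T = {c. \<not> fredholm (op_minus_scalar T c)}"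

typedef (overloaded) ('i, 'e::complex_inner) ell2 =
  "{f :: 'i \<Rightarrow> 'e. (\<lambda>i. (norm (f i))\<^sup>2) summable_on UNIV}"
  by (rule exI[of _ "\<lambda>_. 0"]) simp

setup_lifting type_definition_ell2

abbreviation square_summable :: "('i \<Rightarrow> 'e::complex_inner) \<Rightarrow> bool"
  where "square_summable f \<equiv> (\<lambda>i. (norm (f i))\<^sup>2) summable_on UNIV"

lemma square_summable_add:
  assumes "square_summable f" "square_summable g"
  shows "square_summable (\<lambda>i. f i + g i)"
proof (rule summable_on_comparison_test)
  show "(\<lambda>i. 2 * (norm (f i))\<^sup>2 + 2 * (norm (g i))\<^sup>2) summable_on UNIV"
    by (intro summable_on_add summable_on_cmult_right assms)
  fix i
  have "(norm (f i + g i))\<^sup>2 \<le> (norm (f i) + norm (g i))\<^sup>2"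
    by (intro power_mono norm_triangle_ineq) auto
  also have "\<dots> \<le> 2 * (norm (f i))\<^sup>2 + 2 * (norm (g i))\<^sup>2"
    using zero_le_power2[of "norm (f i) - norm (g i)"] by (simp add: power2_eq_square algebra_simps)
  finally show "(norm (f i + g i))\<^sup>2 \<le> 2 * (norm (f i))\<^sup>2 + 2 * (norm (g i))\<^sup>2" .
qed auto

lemma square_summable_scaleC:
  "square_summable f \<Longrightarrow> square_summable (\<lambda>i. c *\<^sub>C f i)"
  by (simp add: norm_scaleC power_mult_distrib summable_on_cmult_right)

lemma square_summable_uminus:
  "square_summable f \<Longrightarrow> square_summable (\<lambda>i. - f i)"
  by simp

lemma square_summable_diff:
  "square_summable f \<Longrightarrow> square_summable g \<Longrightarrow> square_summable (\<lambda>i. f i - g i)"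
  using square_summable_add[of f "\<lambda>i. - g i"] by simp

lemma square_summable_scaleR:
  "square_summable f \<Longrightarrow> square_summable (\<lambda>i. r *\<^sub>R f i)"
  by (simp add: power_mult_distrib summable_on_cmult_right)

lemma square_summable_cinner:
  assumes "square_summable f" "square_summable g"
  shows "(\<lambda>i. cinner (f i) (g i)) summable_on UNIV"
proof (rule abs_summable_summable, rule summable_on_comparison_test)
  show "(\<lambda>i. (norm (f i))\<^sup>2 + (norm (g i))\<^sup>2) summable_on UNIV"
    by (intro summable_on_add assms)
  fix i
  have "cmod (cinner (f i) (g i)) \<le> norm (f i) * norm (g i)"
    by (rule norm_cinner_le)
  also have "\<dots> \<le> (norm (f i))\<^sup>2 + (norm (g i))\<^sup>2"
    using zero_le_power2[of "norm (f i) - norm (g i)"] zero_le_power2[of "norm (f i)"]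
      zero_le_power2[of "norm (g i)"]
    unfolding power2_diff by linarith
  finally show "cmod (cinner (f i) (g i)) \<le> (norm (f i))\<^sup>2 + (norm (g i))\<^sup>2" .
qed auto

instantiation ell2 :: (type, complex_inner) complex_inner
begin

lift_definition zero_ell2 :: "('a, 'b) ell2" is "\<lambda>_. 0" by simp
lift_definition plus_ell2 :: "('a, 'b) ell2 \<Rightarrow> ('a, 'b) ell2 \<Rightarrow> ('a, 'b) ell2"
  is "\<lambda>f g i. f i + g i" by (rule square_summable_add)
lift_definition minus_ell2 :: "('a, 'b) ell2 \<Rightarrow> ('a, 'b) ell2 \<Rightarrow> ('a, 'b) ell2"
  is "\<lambda>f g i. f i - g i" by (rule square_summable_diff)
lift_definition uminus_ell2 :: "('a, 'b) ell2 \<Rightarrow> ('a, 'b) ell2"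
  is "\<lambda>f i. - f i" by (rule square_summable_uminus)
lift_definition scaleR_ell2 :: "real \<Rightarrow> ('a, 'b) ell2 \<Rightarrow> ('a, 'b) ell2"
  is "\<lambda>r f i. r *\<^sub>R f i" by (rule square_summable_scaleR)
lift_definition scaleC_ell2 :: "complex \<Rightarrow> ('a, 'b) ell2 \<Rightarrow> ('a, 'b) ell2"
  is "\<lambda>c f i. c *\<^sub>C f i" by (rule square_summable_scaleC)
lift_definition cinner_ell2 :: "('a, 'b) ell2 \<Rightarrow> ('a, 'b) ell2 \<Rightarrow> complex"
  is "\<lambda>f g. \<Sum>\<^sub>\<infinity>i. cinner (f i) (g i)" .
lift_definition norm_ell2 :: "('a, 'b) ell2 \<Rightarrow> real"
  is "\<lambda>f. sqrt (\<Sum>\<^sub>\<infinity>i. (norm (f i))\<^sup>2)" .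

definition inner_ell2 :: "('a, 'b) ell2 \<Rightarrow> ('a, 'b) ell2 \<Rightarrow> real"
  where "inner_ell2 x y = Re (cinner x y)"
definition dist_ell2 :: "('a, 'b) ell2 \<Rightarrow> ('a, 'b) ell2 \<Rightarrow> real"
  where "dist_ell2 x y = norm (x - y)"
definition sgn_ell2 :: "('a, 'b) ell2 \<Rightarrow> ('a, 'b) ell2"
  where "sgn_ell2 x = scaleR (inverse (norm x)) x"
definition uniformity_ell2 :: "(('a, 'b) ell2 \<times> ('a, 'b) ell2) filter"
  where "uniformity_ell2 = (INF e\<in>{0<..}. principal {(x, y). dist x y < e})"
definition open_ell2 :: "('a, 'b) ell2 set \<Rightarrow> bool"
  where "open_ell2 U \<longleftrightarrow> (\<forall>x\<in>U. \<forall>\<^sub>F (x', y) in uniformity. x' = x \<longrightarrow> y \<in> U)"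

instance
proof
  fix x y z :: "('a, 'b) ell2" and c d :: complex and r s :: real
  show "x + y + z = x + (y + z)" by transfer (simp add: add.assoc)
  show "x + y = y + x" by transfer (simp add: add.commute)
  show "0 + x = x" by transfer simp
  show "- x + x = 0" by transfer simp
  show "x - y = x + - y" by transfer simp
  show "r *\<^sub>R (x + y) = r *\<^sub>R x + r *\<^sub>R y" by transfer (simp add: scaleR_add_right)
  show "(r + s) *\<^sub>R x = r *\<^sub>R x + s *\<^sub>R x" by transfer (simp add: scaleR_add_left)
  show "r *\<^sub>R s *\<^sub>R x = (r * s) *\<^sub>R x" by transfer simp
  show "1 *\<^sub>R x = x" by transfer simp
  show "sgn x = scaleR (inverse (norm x)) x" by (rule sgn_ell2_def)
  show "dist x y = norm (x - y)" by (rule dist_ell2_def)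
  show "(uniformity :: (('a, 'b) ell2 \<times> ('a, 'b) ell2) filter) =
      (INF e\<in>{0<..}. principal {(x, y). dist x y < e})"
    by (rule uniformity_ell2_def)
  show "open U \<longleftrightarrow> (\<forall>x\<in>U. \<forall>\<^sub>F (x', y) in uniformity. x' = x \<longrightarrow> y \<in> U)"
    for U :: "('a, 'b) ell2 set"
    by (rule open_ell2_def)
  show cadd: "cinner (x + y) z = cinner x z + cinner y z" for x y z :: "('a, 'b) ell2"
    by transfer (simp only: cinner_add_left infsum_add square_summable_cinner)
  show cscale: "cinner (c *\<^sub>C x) y = c * cinner x y" for c and x y :: "('a, 'b) ell2"
    by transfer (simp add: cinner_scaleC_left infsum_cmult_right')
  show ccomm: "cinner x y = cnj (cinner y x)" for x y :: "('a, 'b) ell2"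
  proof transfer
    fix f g :: "'a \<Rightarrow> 'b"
    have "(\<lambda>i. cinner (f i) (g i)) = (\<lambda>i. cnj (cinner (g i) (f i)))"
      by (rule ext) (rule cinner_commute)
    then show "(\<Sum>\<^sub>\<infinity>i. cinner (f i) (g i)) = cnj (\<Sum>\<^sub>\<infinity>i. cinner (g i) (f i))"
      by (simp only: infsum_cnj)
  qed
  show scaleR: "r *\<^sub>R x = complex_of_real r *\<^sub>C x" for r and x :: "('a, 'b) ell2"
    by transfer (simp add: scaleR_scaleC)
  show "c *\<^sub>C (x + y) = c *\<^sub>C x + c *\<^sub>C y" by transfer (simp add: scaleC_add_right)
  show "(c + d) *\<^sub>C x = c *\<^sub>C x + d *\<^sub>C x" by transfer (simp add: scaleC_add_left)
  show "c *\<^sub>C d *\<^sub>C x = (c * d) *\<^sub>C x" by transfer (simp add: scaleC_scaleC)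
  show "inner x y = Re (cinner x y)" by (rule inner_ell2_def)
  show "inner x y = inner y x"
    unfolding inner_ell2_def by (subst ccomm) simp
  show "inner (x + y) z = inner x z + inner y z"
    unfolding inner_ell2_def by (simp add: cadd)
  show "inner (r *\<^sub>R x) y = r * inner x y"
    unfolding inner_ell2_def by (simp add: cscale scaleR)
  have self: "inner x x = (\<Sum>\<^sub>\<infinity>i. (norm (Rep_ell2 x i))\<^sup>2)"
    unfolding inner_ell2_def
  proof transfer
    fix f :: "'a \<Rightarrow> 'b" assume f: "square_summable f"
    have "Re (\<Sum>\<^sub>\<infinity>i. cinner (f i) (f i)) = (\<Sum>\<^sub>\<infinity>i. Re (cinner (f i) (f i)))"
      by (rule infsum_Re[symmetric]) (rule square_summable_cinner[OF f f])
    then show "Re (\<Sum>\<^sub>\<infinity>i. cinner (f i) (f i)) = (\<Sum>\<^sub>\<infinity>i. (norm (f i))\<^sup>2)"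
      by (simp only: cinner_self Re_complex_of_real)
  qed
  show "0 \<le> inner x x"
    unfolding self by (rule infsum_nonneg) simp
  show "norm x = sqrt (inner x x)"
    unfolding self norm_ell2.rep_eq ..
  show "inner x x = 0 \<longleftrightarrow> x = 0"
  proof
    assume "inner x x = 0"
    then have "(\<Sum>\<^sub>\<infinity>i. (norm (Rep_ell2 x i))\<^sup>2) = 0" by (simp add: self)
    then have "(norm (Rep_ell2 x i))\<^sup>2 = 0" for i
      by (intro nonneg_infsum_le_0D[where A = UNIV]) (use Rep_ell2[of x] in auto)
    then show "x = 0"
      by (intro Rep_ell2_inject[THEN iffD1]) (simp add: fun_eq_iff zero_ell2.rep_eq)
  next
    assume "x = 0"
    then have "Rep_ell2 x = (\<lambda>_. 0)" by (simp add: zero_ell2.rep_eq)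
    then show "inner x x = 0" by (simp add: self)
  qed
qed

end

lemma norm_ell2_sq: "(norm x)\<^sup>2 = (\<Sum>\<^sub>\<infinity>i. (norm (Rep_ell2 x i))\<^sup>2)"
  unfolding norm_ell2.rep_eq by (rule real_sqrt_pow2) (simp add: infsum_nonneg)

lemma sum_le_norm_ell2_sq:
  assumes "finite F"
  shows "(\<Sum>i\<in>F. (norm (Rep_ell2 x i))\<^sup>2) \<le> (norm x)\<^sup>2"
  unfolding norm_ell2_sq using Rep_ell2[of x] assms by (intro finite_sum_le_infsum) auto

lemma norm_coord_le_norm_ell2: "norm (Rep_ell2 x i) \<le> norm x"
  using sum_le_norm_ell2_sq[of "{i}" x] by simp

instance ell2 :: (type, complex_hilbert) complex_hilbert
proof
  fix X :: "nat \<Rightarrow> ('a, 'b) ell2"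
  assume X: "Cauchy X"
  have coord: "Cauchy (\<lambda>n. Rep_ell2 (X n) i)" for i
  proof (rule metric_CauchyI)
    fix e :: real assume "e > 0"
    then obtain N where N: "\<And>m n. m \<ge> N \<Longrightarrow> n \<ge> N \<Longrightarrow> dist (X m) (X n) < e"
      using metric_CauchyD[OF X] by blast
    have "dist (Rep_ell2 (X m) i) (Rep_ell2 (X n) i) < e" if "m \<ge> N" "n \<ge> N" for m n
      using N[OF that] norm_coord_le_norm_ell2[of "X m - X n" i]
      by (simp add: dist_norm minus_ell2.rep_eq)
    then show "\<exists>N. \<forall>m\<ge>N. \<forall>n\<ge>N. dist (Rep_ell2 (X m) i) (Rep_ell2 (X n) i) < e" by blast
  qed
  define f where "f i = lim (\<lambda>n. Rep_ell2 (X n) i)" for i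
  have f: "(\<lambda>n. Rep_ell2 (X n) i) \<longlonglongrightarrow> f i" for i
    unfolding f_def using coord Cauchy_convergent convergent_LIMSEQ_iff by blast
  have key: "\<exists>N. \<forall>n\<ge>N. \<forall>F. finite F \<longrightarrow> (\<Sum>i\<in>F. (norm (Rep_ell2 (X n) i - f i))\<^sup>2) \<le> e\<^sup>2"
    if "e > 0" for e :: real
  proof -
    obtain N where N: "\<And>m n. m \<ge> N \<Longrightarrow> n \<ge> N \<Longrightarrow> dist (X m) (X n) < e"
      using metric_CauchyD[OF X \<open>e > 0\<close>] by blast
    have "(\<Sum>i\<in>F. (norm (Rep_ell2 (X n) i - f i))\<^sup>2) \<le> e\<^sup>2" if "n \<ge> N" "finite F" for n F
    proof (rule LIMSEQ_le_const2)
      show "(\<lambda>m. \<Sum>i\<in>F. (norm (Rep_ell2 (X n) i - Rep_ell2 (X m) i))\<^sup>2)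
          \<longlonglongrightarrow> (\<Sum>i\<in>F. (norm (Rep_ell2 (X n) i - f i))\<^sup>2)"
        by (intro tendsto_intros f)
      have "(\<Sum>i\<in>F. (norm (Rep_ell2 (X n) i - Rep_ell2 (X m) i))\<^sup>2) \<le> e\<^sup>2" if "m \<ge> N" for m
      proof -
        have "(\<Sum>i\<in>F. (norm (Rep_ell2 (X n) i - Rep_ell2 (X m) i))\<^sup>2) \<le> (norm (X n - X m))\<^sup>2"
          using sum_le_norm_ell2_sq[OF \<open>finite F\<close>, of "X n - X m"] by (simp add: minus_ell2.rep_eq)
        also have "\<dots> \<le> e\<^sup>2"
          using N[OF \<open>n \<ge> N\<close> that] by (intro power_mono) (auto simp: dist_norm)
        finally show ?thesis .
      qed
      then show "\<exists>N. \<forall>m\<ge>N. (\<Sum>i\<in>F. (norm (Rep_ell2 (X n) i - Rep_ell2 (X m) i))\<^sup>2) \<le> e\<^sup>2" by blast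
    qed
    then show ?thesis by blast
  qed
  have summ: "square_summable (\<lambda>i. Rep_ell2 (X n) i - f i)"
    if "\<And>F. finite F \<Longrightarrow> (\<Sum>i\<in>F. (norm (Rep_ell2 (X n) i - f i))\<^sup>2) \<le> e\<^sup>2" for n and e :: real
    using that by (intro nonneg_bdd_above_summable_on) (auto intro!: bdd_aboveI[of _ "e\<^sup>2"])
  obtain n where "\<And>F. finite F \<Longrightarrow> (\<Sum>i\<in>F. (norm (Rep_ell2 (X n) i - f i))\<^sup>2) \<le> 1\<^sup>2"
    using key[of 1] by auto
  then have d: "square_summable (\<lambda>i. Rep_ell2 (X n) i - f i)" by (rule summ)
  have "square_summable (Rep_ell2 (X n))" using Rep_ell2[of "X n"] by simp
  from square_summable_diff[OF this d] have fs: "square_summable f" by simp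
  have "X \<longlonglongrightarrow> Abs_ell2 f"
  proof (rule metric_LIMSEQ_I)
    fix r :: real assume "r > 0"
    then obtain N where N: "\<And>n F. n \<ge> N \<Longrightarrow> finite F \<Longrightarrow>
        (\<Sum>i\<in>F. (norm (Rep_ell2 (X n) i - f i))\<^sup>2) \<le> (r/2)\<^sup>2"
      using key[of "r/2"] by auto
    have "dist (X n) (Abs_ell2 f) < r" if "n \<ge> N" for n
    proof -
      have "(norm (X n - Abs_ell2 f))\<^sup>2 = (\<Sum>\<^sub>\<infinity>i. (norm (Rep_ell2 (X n) i - f i))\<^sup>2)"
        unfolding norm_ell2_sq by (simp add: minus_ell2.rep_eq Abs_ell2_inverse fs)
      also have "\<dots> \<le> (r/2)\<^sup>2"
        by (intro infsum_le_finite_sums summ[of n "r/2"]) (use N[OF that] in auto)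
      finally have "norm (X n - Abs_ell2 f) \<le> r/2"
        using \<open>r > 0\<close> by (auto intro: power2_le_imp_le)
      then show ?thesis using \<open>r > 0\<close> by (simp add: dist_norm)
    qed
    then show "\<exists>N. \<forall>n\<ge>N. dist (X n) (Abs_ell2 f) < r" by blast
  qed
  then show "convergent X" by (rule convergentI)
qed

text \<open>The alphabet is \<open>{1, ..., n}\<close> with \<open>n = CARD('n)\<close>; as \<open>'n\<close> ranges over the finite types, \<open>n\<close>
  ranges over all integers \<open>n \<ge> 1\<close>.\<close>

typedef 'n::finite letter = "{1..CARD('n)}"
  by (rule exI[of _ 1]) (simp add: Suc_leI)

definition first_letter :: "'n::finite letter"
  where "first_letter = Abs_letter 1"

definition last_letter :: "'n::finite letter"
  where "last_letter = Abs_letter CARD('n)"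

text \<open>Only meaningful for letters other than \<^term>\<open>last_letter\<close>.\<close>

definition next_letter :: "'n::finite letter \<Rightarrow> 'n letter"
  where "next_letter a = Abs_letter (Rep_letter a + 1)"

text \<open>The Hilbert space tensor product of the full Fock space with \<open>'e\<close>, in the orthonormal basis
  \<open>e\<^sub>\<mu>\<close> of the Fock space indexed by words \<open>\<mu>\<close>: the family \<open>f\<close> stands for \<open>\<Sum>\<mu>. e\<^sub>\<mu> \<otimes> f \<mu>\<close>.\<close>

type_synonym ('n, 'e) fock = "('n letter list, 'e) ell2"

text \<open>\<open>word_tensor \<mu> \<eta>\<close> is \<open>e\<^sub>\<mu> \<otimes> \<eta>\<close>, with \<open>\<Omega> \<otimes> \<eta>\<close> for the empty word.\<close>

lift_definition word_tensor :: "'n::finite letter list \<Rightarrow> 'e::complex_inner \<Rightarrow> ('n, 'e) fock"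
  is "\<lambda>\<mu> \<eta> w. if w = \<mu> then \<eta> else 0"
proof -
  fix \<mu> :: "'n letter list" and \<eta> :: 'e
  have "(\<lambda>w. (norm (if w = \<mu> then \<eta> else 0))\<^sup>2) summable_on {\<mu>}"
    by (rule summable_on_finite) simp
  then show "square_summable (\<lambda>w. if w = \<mu> then \<eta> else 0)"
    by (rule summable_on_cong_neutral[THEN iffD1, rotated -1]) auto
qed

text \<open>\<open>left_tensor \<mu> f\<close> is \<open>e\<^sub>\<mu> \<otimes> f\<close>, determined by \<open>e\<^sub>\<mu> \<otimes> (e\<^sub>\<nu> \<otimes> \<eta>) = e\<^bsub>\<mu>\<nu>\<^esub> \<otimes> \<eta>\<close>.\<close>

lift_definition left_tensor ::
    "'n::finite letter list \<Rightarrow> ('n, 'e::complex_inner) fock \<Rightarrow> ('n, 'e) fock"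
  is "\<lambda>\<mu> f w. if take (length \<mu>) w = \<mu> then f (drop (length \<mu>) w) else 0"
proof -
  fix \<mu> :: "'n letter list" and f :: "'n letter list \<Rightarrow> 'e"
  assume f: "square_summable f"
  let ?g = "\<lambda>w. if take (length \<mu>) w = \<mu> then f (drop (length \<mu>) w) else 0"
  have "((\<lambda>w. (norm (?g w))\<^sup>2) \<circ> (\<lambda>v. \<mu> @ v)) summable_on UNIV"
    using f by (simp add: o_def)
  then have "(\<lambda>w. (norm (?g w))\<^sup>2) summable_on range (\<lambda>v. \<mu> @ v)"
    by (subst summable_on_reindex) (auto simp: inj_on_def)
  moreover have "?g w = 0" if "w \<notin> range (\<lambda>v. \<mu> @ v)" for w
    using that append_take_drop_id[of "length \<mu>" w] by (metis rangeI)
  ultimately show "square_summable ?g"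
    by (subst summable_on_cong_neutral[where S = UNIV and T = "range (\<lambda>v. \<mu> @ v)"
          and g = "\<lambda>w. (norm (?g w))\<^sup>2"]) auto
qed

lemma left_tensor_word_tensor: "left_tensor \<mu> (word_tensor \<nu> \<eta>) = word_tensor (\<mu> @ \<nu>) \<eta>"
proof (transfer, rule ext)
  fix \<mu> \<nu> w :: "'a letter list" and \<eta> :: 'b
  have "w = \<mu> @ \<nu> \<longleftrightarrow> take (length \<mu>) w = \<mu> \<and> drop (length \<mu>) w = \<nu>"
    using append_eq_conv_conj[of \<mu> \<nu> w] by metis
  then show "(if take (length \<mu>) w = \<mu> then if drop (length \<mu>) w = \<nu> then \<eta> else 0 else 0) =
      (if w = \<mu> @ \<nu> then \<eta> else 0)"
    by metis
qed

text \<open>\<open>W\<close> is the bounded operator \<open>W\<^sub>L\<close>: the clauses fix \<open>W\<close> on the total set of vectors \<open>e\<^sub>\<mu> \<otimes> \<eta>\<close>.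
  In the last one, \<open>\<mu> = n \<dots> n a \<nu>\<close> with exactly \<open>k\<close> leading letters \<open>n\<close> and \<open>a \<noteq> n\<close>.\<close>

definition odometer_map ::
    "('e \<Rightarrow> ('n, 'e) fock) \<Rightarrow> (('n::finite, 'e::complex_inner) fock \<Rightarrow> ('n, 'e) fock) \<Rightarrow> bool"
  where "odometer_map L W \<longleftrightarrow> bounded_clinear W \<and>
    (\<forall>\<eta>. W (word_tensor [] \<eta>) = L \<eta>) \<and>
    (\<forall>m\<ge>1. \<forall>\<eta>. W (word_tensor (replicate m last_letter) \<eta>)
        = left_tensor (replicate m first_letter) (L \<eta>)) \<and>
    (\<forall>k a \<nu> \<eta>. a \<noteq> last_letter \<longrightarrow>
        W (word_tensor (replicate k last_letter @ [a] @ \<nu>) \<eta>)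
          = word_tensor (replicate k first_letter @ [next_letter a] @ \<nu>) \<eta>)"

definition odometer_space ::
    "('e \<Rightarrow> ('n, 'e) fock) \<Rightarrow> ('n::finite, 'e::complex_inner) fock set"
  where "odometer_space L =
    closure (cspan {word_tensor (replicate m first_letter) \<eta> |m \<eta>. True}) \<ominus>
    closure (cspan {left_tensor (replicate p first_letter) (L \<zeta>) |p \<zeta>. p \<ge> 1})"

end

theory Submission
  imports Defs
begin

text \<open>The odometer map sends \<open>e\<^sub>\<mu> \<otimes> \<eta>\<close>, for \<open>\<mu>\<close> not a power of the last letter, onto exactly those
  \<open>e\<^sub>\<nu> \<otimes> \<eta>\<close> for which \<open>\<nu>\<close> is not a power of the first letter; hence \<open>ker W\<^sup>*\<close> consists of the
  vectors supported on powers of the first letter that are orthogonal to the remaining values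
  \<open>e\<^sub>1\<^sup>m \<otimes> L \<eta>\<close>. The rest holds for any isometry \<open>W\<close>: for \<open>|c| < 1\<close> the operator \<open>W - c\<close> is bounded
  below, and the invertible operator \<open>I - cnj c W\<close> maps \<open>ker (W - c)\<^sup>*\<close> onto \<open>ker W\<^sup>*\<close>; for \<open>|c| > 1\<close>
  the operator \<open>W - c\<close> is invertible; for \<open>|c| = 1\<close> it has closed range only if
  \<open>ker W\<^sup>* = 0\<close>.\<close>

section \<open>Complex inner product spaces\<close>

lemma cinner_diff_left: "cinner (x - y) z = cinner x z - cinner y (z::'a::complex_inner)"
  using cinner_add_left[of "x - y" y z] by simp

lemma cinner_diff_right: "cinner z (x - y) = cinner z x - cinner z (y::'a::complex_inner)"
  using cinner_add_right[of z "x - y" y] by simp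

lemma cinner_zero_left [simp]: "cinner 0 (z::'a::complex_inner) = 0"
  using cinner_diff_left[of 0 0 z] by simp

lemma cinner_zero_right [simp]: "cinner z (0::'a::complex_inner) = 0"
  using cinner_diff_right[of z 0 0] by simp

lemma cinner_eq_zero_swap: "cinner x y = 0 \<longleftrightarrow> cinner y (x::'a::complex_inner) = 0"
  by (metis cinner_commute complex_cnj_zero)

lemma cinner_self_eq_zero: "cinner x x = 0 \<longleftrightarrow> x = (0::'a::complex_inner)"
  by (simp add: cinner_self)

lemma cinner_left_eqI:
  assumes "\<And>x. cinner x y = cinner x z"
  shows "y = (z::'a::complex_inner)"
proof -
  have "cinner (y - z) (y - z) = 0"
    using assms[of "y - z"] by (simp add: cinner_diff_right)
  then show ?thesis
    by (simp add: cinner_self_eq_zero)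
qed

lemma bounded_linear_cinner_left: "bounded_linear (\<lambda>x. cinner x (y::'a::complex_inner))"
  by (rule bounded_linear_intro[of _ "norm y"])
    (simp_all add: cinner_add_left scaleR_scaleC cinner_scaleC_left scaleR_conv_of_real
      norm_cinner_le)

text \<open>With \<open>inner_eq_Re_cinner\<close>, this carries facts about the real inner product
  over to \<open>cinner\<close>.\<close>

lemma Im_cinner: "Im (cinner x y) = inner (- \<i> *\<^sub>C x) (y::'a::complex_inner)"
  unfolding inner_eq_Re_cinner cinner_scaleC_left by simp

text \<open>The vectors orthogonal to \<open>z\<close> form a closed subspace, and one that contains
  \<open>A\<close> contains its closed span.\<close>

lemma orthogonal_closure_cspan:
  assumes "\<And>y. y \<in> A \<Longrightarrow> cinner y z = 0" and "x \<in> closure (cspan A)"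
  shows "cinner x (z::'a::complex_inner) = 0"
proof -
  let ?N = "{x. cinner x z = 0}"
  have "complex_vector.subspace ?N"
    by (simp add: complex_vector.subspace_def cinner_add_left cinner_scaleC_left)
  then have "cspan A \<subseteq> ?N"
    using assms(1) by (intro complex_vector.span_minimal) auto
  moreover have "closed ?N"
    by (intro closed_Collect_eq continuous_intros
        linear_continuous_on bounded_linear_cinner_left)
  ultimately have "closure (cspan A) \<subseteq> ?N"
    by (rule closure_minimal)
  then show ?thesis
    using assms(2) by auto
qed

lemma csubspace_closure:
  assumes "complex_vector.subspace (M::'a::complex_inner set)"
  shows "complex_vector.subspace (closure M)"
proof (rule complex_vector.subspaceI)
  show "0 \<in> closure M"
    using assms closure_subset complex_vector.subspace_0 by blast
next
  fix x y assume "x \<in> closure M" "y \<in> closure M"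
  then obtain f g where "\<And>n. f n \<in> M" "f \<longlonglongrightarrow> x" "\<And>n. g n \<in> M" "g \<longlonglongrightarrow> y"
    unfolding closure_sequential by auto
  then have "(\<lambda>n. f n + g n) \<longlonglongrightarrow> x + y" "\<And>n. f n + g n \<in> M"
    using assms by (auto intro: tendsto_add complex_vector.subspace_add)
  then show "x + y \<in> closure M"
    unfolding closure_sequential by (intro exI[of _ "\<lambda>n. f n + g n"]) auto
next
  fix c x assume "x \<in> closure M"
  then obtain f where f: "\<And>n. f n \<in> M" "f \<longlonglongrightarrow> x"
    unfolding closure_sequential by auto
  have "bounded_linear (\<lambda>x::'a. c *\<^sub>C x)"
    by (rule bounded_linear_intro[of _ "cmod c"])
      (simp_all add: scaleC_add_right scaleR_scaleC scaleC_scaleC norm_scaleC mult.commute)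
  then have "(\<lambda>n. c *\<^sub>C f n) \<longlonglongrightarrow> c *\<^sub>C x"
    using f(2) by (rule bounded_linear.tendsto)
  moreover have "\<And>n. c *\<^sub>C f n \<in> M"
    using assms f(1) by (simp add: complex_vector.subspace_scale)
  ultimately show "c *\<^sub>C x \<in> closure M"
    unfolding closure_sequential by (intro exI[of _ "\<lambda>n. c *\<^sub>C f n"]) auto
qed

section \<open>Orthogonal projections and adjoints\<close>

text \<open>The sets \<open>S n\<close> of almost nearest points are closed, nonempty and
  decreasing, and their diameters tend to 0; by completeness they have a common point.\<close>

lemma exists_nearest_point:
  fixes M :: "'a::complex_hilbert set"
  assumes M: "complex_vector.subspace M" "closed M"
  obtains p where "p \<in> M" "\<And>y. y \<in> M \<Longrightarrow> norm (x - p) \<le> norm (x - y)"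
proof -
  define D where "D = (INF y\<in>M. (norm (x - y))\<^sup>2)"
  define S where "S n = {y \<in> M. (norm (x - y))\<^sup>2 \<le> D + 1 / real (Suc n)}" for n
  have bdd: "bdd_below ((\<lambda>y. (norm (x - y))\<^sup>2) ` M)"
    by (rule bdd_belowI[of _ 0]) auto
  have D: "D \<le> (norm (x - y))\<^sup>2" if "y \<in> M" for y
    unfolding D_def using bdd that by (rule cINF_lower)
  have ne: "M \<noteq> {}"
    using M(1) complex_vector.subspace_0 by blast
  obtain a where a: "\<And>n. a \<in> S n"
  proof (rule decreasing_closed_nest)
    show "closed (S n)" for n
    proof -
      have "S n = M \<inter> {y. (norm (x - y))\<^sup>2 \<le> D + 1 / real (Suc n)}"
        by (auto simp: S_def)
      then show ?thesis
        by (simp only:) (intro closed_Int M closed_Collect_le continuous_intros)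
    qed
    show "S n \<noteq> {}" for n
    proof -
      have "D < D + 1 / real (Suc n)" by simp
      then obtain y where "y \<in> M" "(norm (x - y))\<^sup>2 < D + 1 / real (Suc n)"
        unfolding D_def using cINF_less_iff[OF ne bdd] by blast
      then show ?thesis
        unfolding S_def by (auto intro: less_imp_le)
    qed
    show "S n \<subseteq> S m" if "m \<le> n" for m n
    proof -
      have "1 / real (Suc n) \<le> 1 / real (Suc m)"
        using that by (simp add: field_simps)
      then show ?thesis
        unfolding S_def by auto
    qed
    show "\<exists>n. \<forall>y\<in>S n. \<forall>z\<in>S n. dist y z < e" if "e > 0" for e :: real
    proof -
      have "e\<^sup>2 / 4 > 0"
        using that by simp
      then obtain n where n: "1 / real (Suc n) < e\<^sup>2 / 4"
        using nat_approx_posE by metis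
      have "dist y z < e" if yz: "y \<in> S n" "z \<in> S n" for y z
      proof -
        \<comment> \<open>The midpoint stays in \<open>M\<close>, so its squared distance to
          \<open>x\<close> is at least \<open>D\<close>; the parallelogram identity then forces
          \<open>y\<close> and \<open>z\<close> together.\<close>
        define w where "w = (1/2) *\<^sub>R (y + z)"
        have "w \<in> M"
          using yz M(1) unfolding w_def S_def scaleR_scaleC
          by (auto intro: complex_vector.subspace_scale complex_vector.subspace_add)
        then have w: "D \<le> (norm (x - w))\<^sup>2" by (rule D)
        have "(norm (y - z))\<^sup>2
            = 2 * (norm (x - y))\<^sup>2 + 2 * (norm (x - z))\<^sup>2 - 4 * (norm (x - w))\<^sup>2"
          unfolding w_def power2_norm_eq_inner by (simp add: algebra_simps inner_commute)
        also have "\<dots> \<le> 4 * (1 / real (Suc n))"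
          using yz w unfolding S_def mem_Collect_eq by argo
        also have "\<dots> < e\<^sup>2"
          using n by simp
        finally have "norm (y - z) < e"
          using \<open>e > 0\<close> by (auto intro: power2_less_imp_less)
        then show ?thesis by (simp add: dist_norm)
      qed
      then show ?thesis by blast
    qed
  qed (rule that)
  have "a \<in> M"
    using a[of 0] by (simp add: S_def)
  moreover have "norm (x - a) \<le> norm (x - y)" if "y \<in> M" for y
  proof -
    have "(norm (x - a))\<^sup>2 \<le> D"
    proof (rule field_le_epsilon)
      fix e :: real assume "e > 0"
      then obtain n where "1 / real (Suc n) < e"
        using nat_approx_posE by metis
      then show "(norm (x - a))\<^sup>2 \<le> D + e"
        using a[of n] by (simp add: S_def)
    qed
    also have "\<dots> \<le> (norm (x - y))\<^sup>2"
      using that by (rule D)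
    finally show ?thesis
      by (rule power2_le_imp_le) simp
  qed
  ultimately show thesis
    by (rule that)
qed

text \<open>The nearest point works: moving it within \<open>M\<close> along \<open>y\<close> cannot
  bring it closer to \<open>x\<close>, so the real inner product of \<open>y\<close> with
  \<open>x - p\<close> vanishes.\<close>

lemma orthogonal_decomposition:
  fixes M :: "'a::complex_hilbert set"
  assumes M: "complex_vector.subspace M" "closed M"
  obtains p where "p \<in> M" "\<And>y. y \<in> M \<Longrightarrow> cinner y (x - p) = 0"
proof -
  obtain p where p: "p \<in> M" "\<And>y. y \<in> M \<Longrightarrow> norm (x - p) \<le> norm (x - y)"
    using exists_nearest_point[OF M, of x] by metis
  have inner0: "inner y (x - p) = 0" if y: "y \<in> M" for y
  proof (cases "y = 0")
    case False
    \<comment> \<open>The minimiser in \<open>t\<close> of the squared norm of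
      \<open>x - p - t y\<close>.\<close>
    define t where "t = inner y (x - p) / (norm y)\<^sup>2"
    have "p + t *\<^sub>R y \<in> M"
      using M(1) p(1) y unfolding scaleR_scaleC
      by (intro complex_vector.subspace_add complex_vector.subspace_scale)
    then have "(norm (x - p))\<^sup>2 \<le> (norm (x - (p + t *\<^sub>R y)))\<^sup>2"
      using p(2) by (intro power_mono) auto
    also have "x - (p + t *\<^sub>R y) = (x - p) - t *\<^sub>R y"
      by simp
    also have "(norm \<dots>)\<^sup>2 = (norm (x - p))\<^sup>2 - 2 * t * inner y (x - p) + t\<^sup>2 * (norm y)\<^sup>2"
      unfolding power2_norm_eq_inner inner_diff_left[of "x - p"] inner_diff_right[of _ "x - p"]
        inner_scaleR_left inner_scaleR_right inner_commute[of "x - p" y]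
      by (simp add: power2_eq_square algebra_simps)
    also have "\<dots> = (norm (x - p))\<^sup>2 - (inner y (x - p))\<^sup>2 / (norm y)\<^sup>2"
      using False by (simp add: t_def field_simps power2_eq_square)
    finally have "(inner y (x - p))\<^sup>2 / (norm y)\<^sup>2 \<le> 0"
      by simp
    then show ?thesis
      using False by (simp add: divide_le_0_iff)
  qed simp
  have "cinner y (x - p) = 0" if "y \<in> M" for y
  proof -
    \<comment> \<open>The real inner product of this vector with \<open>x - p\<close> is the
      imaginary part of \<open>cinner y (x - p)\<close>.\<close>
    have "- \<i> *\<^sub>C y \<in> M"
      using M(1) that by (rule complex_vector.subspace_scale)
    then show ?thesis
      using inner0[OF that] inner0[of "- \<i> *\<^sub>C y"]
      by (simp add: complex_eq_iff inner_eq_Re_cinner Im_cinner)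
  qed
  with p(1) show thesis
    by (rule that)
qed

text \<open>For nonzero \<open>f\<close>, let \<open>v\<close> be the part of some \<open>u\<close>
  outside the kernel that is orthogonal to the kernel. Every \<open>x\<close> is a multiple of
  \<open>v\<close> plus an element of the kernel, so pairing with \<open>v\<close> recovers
  \<open>f x\<close> up to a scalar.\<close>

lemma riesz_representation:
  fixes f :: "'a::complex_hilbert \<Rightarrow> complex"
  assumes f: "bounded_linear f" and fC: "\<And>c x. f (c *\<^sub>C x) = c * f x"
  shows "\<exists>z. \<forall>x. f x = cinner x z"
proof (cases "\<forall>x. f x = 0")
  case True
  then show ?thesis by (intro exI[of _ 0]) simp
next
  case False
  then obtain u where u: "f u \<noteq> 0" by blast
  interpret f: bounded_linear f by (rule f)
  have "complex_vector.subspace {x. f x = 0}"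
    by (simp add: complex_vector.subspace_def f.add fC f.zero)
  moreover have "closed {x. f x = 0}"
    by (intro closed_Collect_eq continuous_intros linear_continuous_on f)
  ultimately obtain p where p: "f p = 0" "\<And>y. f y = 0 \<Longrightarrow> cinner y (u - p) = 0"
    using orthogonal_decomposition[of "{x. f x = 0}" u] by auto
  define v where "v = u - p"
  have fv: "f v \<noteq> 0"
    using u p(1) by (simp add: v_def f.diff)
  then have v: "v \<noteq> 0"
    using f.zero by auto
  have "f x = cinner x ((cnj (f v) / complex_of_real ((norm v)\<^sup>2)) *\<^sub>C v)" for x
  proof -
    have "f (x - (f x / f v) *\<^sub>C v) = 0"
      using fv by (simp add: f.diff fC)
    then have "cinner (x - (f x / f v) *\<^sub>C v) v = 0"
      using p(2) v_def by blast
    then have "cinner x v = f x / f v * complex_of_real ((norm v)\<^sup>2)"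
      by (simp add: cinner_diff_left cinner_scaleC_left cinner_self)
    then show ?thesis
      using fv v by (simp add: cinner_scaleC_right)
  qed
  then show ?thesis by blast
qed

text \<open>Riesz representation, applied for each \<open>y\<close>, yields an adjoint, and
  \<open>cinner_left_eqI\<close> its uniqueness; hence the definite description denotes it.\<close>

lemma cinner_hilbert_adjoint:
  fixes T :: "'a::complex_hilbert \<Rightarrow> 'b::complex_hilbert"
  assumes T: "bounded_clinear T"
  shows "cinner (T x) y = cinner x (hilbert_adjoint T y)"
proof -
  have "\<exists>z. \<forall>x. cinner (T x) y = cinner x z" for y
  proof (rule riesz_representation)
    show "bounded_linear (\<lambda>x. cinner (T x) y)"
      using T bounded_linear_compose[OF bounded_linear_cinner_left]
      by (auto simp: bounded_clinear_def)
    show "cinner (T (c *\<^sub>C x)) y = c * cinner (T x) y" for c x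
      using T by (simp add: bounded_clinear_def cinner_scaleC_left)
  qed
  then obtain S where S: "\<forall>x y. cinner (T x) y = cinner x (S y)"
    by metis
  have "\<forall>x y. cinner (T x) y = cinner x (hilbert_adjoint T y)"
    unfolding hilbert_adjoint_def
  proof (rule theI[of _ S])
    fix R assume R: "\<forall>x y. cinner (T x) y = cinner x (R y)"
    show "R = S"
    proof
      show "R y = S y" for y
        by (rule cinner_left_eqI) (metis R S)
    qed
  qed (rule S)
  then show ?thesis by blast
qed

lemma kernel_hilbert_adjoint:
  fixes T :: "'a::complex_hilbert \<Rightarrow> 'b::complex_hilbert"
  assumes "bounded_clinear T"
  shows "op_kernel (hilbert_adjoint T) = {y. \<forall>x. cinner (T x) y = 0}"
  unfolding op_kernel_def cinner_hilbert_adjoint[OF assms]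
  by (metis cinner_self_eq_zero cinner_zero_right)

lemma bounded_clinear_op_minus_scalar:
  assumes "bounded_clinear T"
  shows "bounded_clinear (op_minus_scalar T (c::complex))"
proof -
  have "bounded_linear (\<lambda>x::'a. c *\<^sub>C x)"
    by (rule bounded_linear_intro[of _ "cmod c"])
      (simp_all add: scaleC_add_right scaleR_scaleC scaleC_scaleC norm_scaleC mult.commute)
  then show ?thesis
    using assms unfolding bounded_clinear_def op_minus_scalar_def
    by (auto intro!: bounded_linear_sub
        simp: complex_vector.scale_right_diff_distrib scaleC_scaleC mult.commute)
qed

text \<open>At the level of kernels, the adjoint of \<open>T - c\<close> is the adjoint of
  \<open>T\<close> minus \<open>cnj c\<close>.\<close>

lemma kernel_adjoint_op_minus_scalar:
  fixes T :: "'a::complex_hilbert \<Rightarrow> 'a"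
  assumes T: "bounded_clinear T"
  shows "op_kernel (hilbert_adjoint (op_minus_scalar T c)) = {y. hilbert_adjoint T y = cnj c *\<^sub>C y}"
proof -
  have "cinner (op_minus_scalar T c x) y = cinner x (hilbert_adjoint T y) - cinner x (cnj c *\<^sub>C y)"
    for x y
    by (simp add: op_minus_scalar_def cinner_diff_left cinner_scaleC_left cinner_scaleC_right
        cinner_hilbert_adjoint[OF T])
  then show ?thesis
    unfolding kernel_hilbert_adjoint[OF bounded_clinear_op_minus_scalar[OF T]]
    by (auto intro: cinner_left_eqI)
qed

lemma csubspace_range:
  assumes "bounded_clinear T"
  shows "complex_vector.subspace (range T)"
proof -
  interpret bounded_linear T
    using assms by (simp add: bounded_clinear_def)
  show ?thesis
  proof (rule complex_vector.subspaceI)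
    show "0 \<in> range T" using zero by (metis rangeI)
    show "x + y \<in> range T" if "x \<in> range T" "y \<in> range T" for x y
      using that by (auto simp flip: add)
    show "c *\<^sub>C x \<in> range T" if "x \<in> range T" for c x
      using that assms by (auto simp: bounded_clinear_def image_iff) metis
  qed
qed

section \<open>Dimension under injective linear maps\<close>

text \<open>The image of a basis \<open>B\<close> is independent, has the same cardinality and spans
  the image of \<open>V\<close>. If it lies in the span of a finite set, it is finite, and then so
  is \<open>B\<close>.\<close>

lemma
  fixes f :: "'a::complex_inner \<Rightarrow> 'b::complex_inner"
  assumes f: "Vector_Spaces.linear scaleC scaleC f" and inj: "inj f"
  shows cdim_injective_image: "cdim (f ` V) = cdim V"
    and findim_injective_image: "findim (f ` V) \<Longrightarrow> findim V"
proof -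
  interpret f: Vector_Spaces.linear scaleC scaleC f by (rule f)
  obtain B where B: "B \<subseteq> V" "complex_vector.independent B" "V \<subseteq> cspan B" "card B = cdim V"
    using complex_vector.basis_exists[of V] by metis
  have ind: "complex_vector.independent (f ` B)"
    using B(2) inj by (intro f.independent_injective_image) (auto intro: inj_on_subset)
  have "f ` V \<subseteq> cspan (f ` B)"
    using f.spans_image[of V B] B(3) by (simp add: cspan_def)
  moreover have "card (f ` B) = cdim V"
    using B(4) inj by (simp add: card_image inj_on_subset[OF inj])
  ultimately show "cdim (f ` V) = cdim V"
    using B(1) ind by (intro complex_vector.dim_unique[of "f ` B"]) auto
  show "findim V" if fin: "findim (f ` V)"
  proof -
    obtain C where "finite C" "f ` V \<subseteq> cspan C"
      using fin by (auto simp: findim_def)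
    moreover have "f ` B \<subseteq> f ` V"
      using B(1) by (rule image_mono)
    ultimately have "finite (f ` B)"
      using complex_vector.independent_span_bound[of C "f ` B"] ind by simp
    then have "finite B"
      using inj by (metis finite_imageD inj_on_subset subset_UNIV)
    then show ?thesis
      using B(3) by (auto simp: findim_def)
  qed
qed

section \<open>Isometries\<close>

context
  fixes W :: "'a::complex_hilbert \<Rightarrow> 'a"
  assumes W: "isometric W"
begin

section \<open>Algebra of an isometry and its adjoint\<close>

lemma isometric_bounded_clinear: "bounded_clinear W"
  using W by (simp add: isometric_def)

lemma isometric_linear: "linear W"
  using isometric_bounded_clinear by (simp add: bounded_clinear_def bounded_linear.linear)

lemma isometric_scaleC: "W (c *\<^sub>C x) = c *\<^sub>C W x"
  using isometric_bounded_clinear by (simp add: bounded_clinear_def)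

lemma isometric_norm: "norm (W x) = norm x"
  using W by (simp add: isometric_def)

text \<open>Polarisation gives the real part; \<open>Im_cinner\<close> and complex linearity give
  the imaginary part.\<close>

lemma isometric_cinner: "cinner (W x) (W y) = cinner x y"
proof -
  have "inner (W x) (W y) = inner x y" for x y
    unfolding dot_norm by (simp flip: linear_add[OF isometric_linear] add: isometric_norm)
  then show ?thesis
    by (simp add: complex_eq_iff Im_cinner inner_eq_Re_cinner[symmetric]
        flip: isometric_scaleC)
qed

lemma adjoint_isometric: "hilbert_adjoint W (W x) = x"
proof (rule cinner_left_eqI)
  show "cinner z (hilbert_adjoint W (W x)) = cinner z x" for z
    unfolding cinner_hilbert_adjoint[OF isometric_bounded_clinear, symmetric]
    by (rule isometric_cinner)
qed

text \<open>The reverse triangle inequality for \<open>W x\<close> and \<open>c x\<close>. Off the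
  unit circle it makes \<open>W - c\<close> bounded below, hence injective with closed
  range.\<close>

lemma norm_op_minus_scalar_ge: "\<bar>1 - cmod c\<bar> * norm x \<le> norm (op_minus_scalar W c x)"
  using norm_triangle_ineq3[of "W x" "c *\<^sub>C x"] abs_mult[of "1 - cmod c" "norm x"]
  by (simp add: op_minus_scalar_def isometric_norm norm_scaleC left_diff_distrib)

lemma kernel_op_minus_scalar:
  assumes "cmod c \<noteq> 1"
  shows "op_kernel (op_minus_scalar W c) = {0}"
proof -
  have "x = 0" if "op_minus_scalar W c x = 0" for x
    using norm_op_minus_scalar_ge[of c x] that assms by (simp add: mult_le_0_iff)
  moreover have "op_minus_scalar W c 0 = 0"
    by (simp add: op_minus_scalar_def linear_0[OF isometric_linear])
  ultimately show ?thesis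
    unfolding op_kernel_def by blast
qed

lemma closed_range_op_minus_scalar:
  assumes "cmod c \<noteq> 1"
  shows "closed (range (op_minus_scalar W c))"
proof -
  have "bounded_linear (op_minus_scalar W c)"
    using bounded_clinear_op_minus_scalar[OF isometric_bounded_clinear]
    by (simp add: bounded_clinear_def)
  then have "complete (range (op_minus_scalar W c))"
    using assms norm_op_minus_scalar_ge[of c]
    by (intro complete_isometric_image[of "\<bar>1 - cmod c\<bar>"]) (auto simp: complete_UNIV)
  then show ?thesis
    by (rule complete_imp_closed)
qed

lemma closed_range_isometric: "closed (range W)"
  using closed_range_op_minus_scalar[of 0] by (simp add: op_minus_scalar_def)

text \<open>The kernel of the adjoint is the orthogonal complement of the closed range. If it is
  trivial, \<open>W\<close> is surjective, and its left inverse, the adjoint, is two-sided.\<close>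

lemma unitary_if_kernel_adjoint_trivial:
  assumes "op_kernel (hilbert_adjoint W) \<subseteq> {0}"
  shows "unitary W"
proof -
  have "y \<in> range W" for y
  proof -
    obtain p where p: "p \<in> range W" "\<And>z. z \<in> range W \<Longrightarrow> cinner z (y - p) = 0"
      using orthogonal_decomposition[OF csubspace_range[OF isometric_bounded_clinear]
          closed_range_isometric] by metis
    then have "y - p \<in> op_kernel (hilbert_adjoint W)"
      by (simp add: kernel_hilbert_adjoint[OF isometric_bounded_clinear])
    then show ?thesis
      using assms p(1) by auto
  qed
  then have "W (hilbert_adjoint W y) = y" for y
    by (metis adjoint_isometric rangeE)
  then show ?thesis
    by (simp add: unitary_def isometric_bounded_clinear adjoint_isometric fun_eq_iff)
qed

text \<open>Solving \<open>x - c W x = y\<close> means finding a fixed point of a contraction with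
  constant \<open>cmod c\<close>.\<close>

lemma id_minus_scalar_bij:
  assumes "cmod c < 1"
  shows "bij (\<lambda>x. x - c *\<^sub>C W x)"
proof -
  have "\<exists>!x. y + c *\<^sub>C W x = x" for y
  proof (rule banach_fix_type)
    show "\<forall>u v. dist (y + c *\<^sub>C W u) (y + c *\<^sub>C W v) \<le> cmod c * dist u v"
      by (simp add: dist_norm norm_scaleC isometric_norm
          flip: complex_vector.scale_right_diff_distrib linear_diff[OF isometric_linear])
  qed (use assms in auto)
  then show ?thesis
    unfolding bij_iff by (metis add_diff_cancel_right' diff_add_cancel)
qed

lemma linear_id_minus_scalar: "Vector_Spaces.linear scaleC scaleC (\<lambda>x. x - c *\<^sub>C W x)"
  by unfold_locales
    (simp_all add: linear_add[OF isometric_linear] isometric_scaleC scaleC_add_right scaleC_scaleC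
      complex_vector.scale_right_diff_distrib mult.commute)

text \<open>The eigenvectors of the adjoint are the Neumann series
  \<open>(I - c W)\<^sup>-\<^sup>1 k = \<Sum>j. c\<^sup>j W\<^sup>j k\<close> of the vectors \<open>k\<close> in its kernel.\<close>

lemma kernel_adjoint_eq_image:
  assumes "cmod c < 1"
  shows "op_kernel (hilbert_adjoint W) =
    (\<lambda>x. x - cnj c *\<^sub>C W x) ` op_kernel (hilbert_adjoint (op_minus_scalar W c))"
proof -
  let ?f = "\<lambda>x. x - cnj c *\<^sub>C W x"
  \<comment> \<open>Both memberships are the same condition: for every \<open>z\<close>,
    \<open>cinner (W z) (?f x)\<close> equals \<open>cinner (W z) x - c * cinner z x\<close>, since
    \<open>cinner\<close> is conjugate linear on the right and \<open>W\<close> preserves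
    it.\<close>
  have *: "?f x \<in> op_kernel (hilbert_adjoint W)
      \<longleftrightarrow> x \<in> op_kernel (hilbert_adjoint (op_minus_scalar W c))" for x
    unfolding kernel_hilbert_adjoint[OF isometric_bounded_clinear]
      kernel_hilbert_adjoint[OF bounded_clinear_op_minus_scalar[OF isometric_bounded_clinear]]
    by (simp add: op_minus_scalar_def cinner_diff_left cinner_diff_right cinner_scaleC_left
        cinner_scaleC_right isometric_cinner)
  have "surj ?f"
    using id_minus_scalar_bij[of "cnj c"] assms by (simp add: bij_is_surj)
  moreover have "op_kernel (hilbert_adjoint (op_minus_scalar W c))
      = ?f -` op_kernel (hilbert_adjoint W)"
    using * by blast
  ultimately show ?thesis
    by (simp only: surj_image_vimage_eq)
qed

lemma cdim_kernel_adjoint_op_minus_scalar: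
  assumes "cmod c < 1"
  shows "cdim (op_kernel (hilbert_adjoint (op_minus_scalar W c)))
    = cdim (op_kernel (hilbert_adjoint W))"
proof -
  have "inj (\<lambda>x. x - cnj c *\<^sub>C W x)"
    using assms by (intro bij_is_inj id_minus_scalar_bij) simp
  then show ?thesis
    by (simp only: kernel_adjoint_eq_image[OF assms] cdim_injective_image[OF linear_id_minus_scalar])
qed

lemma findim_kernel_adjoint_op_minus_scalar:
  assumes "cmod c < 1" and "findim (op_kernel (hilbert_adjoint W))"
  shows "findim (op_kernel (hilbert_adjoint (op_minus_scalar W c)))"
proof (rule findim_injective_image[OF linear_id_minus_scalar])
  show "inj (\<lambda>x. x - cnj c *\<^sub>C W x)"
    using assms(1) by (intro bij_is_inj id_minus_scalar_bij) simp
  show "findim ((\<lambda>x. x - cnj c *\<^sub>C W x) ` op_kernel (hilbert_adjoint (op_minus_scalar W c)))"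
    using assms by (simp only: kernel_adjoint_eq_image)
qed

lemma findim_zero: "findim {0}"
  unfolding findim_def by (rule exI[of _ "{}"]) simp

lemma fredholm_inside:
  assumes "cmod c < 1" and "findim (op_kernel (hilbert_adjoint W))"
  shows "fredholm (op_minus_scalar W c)"
  using assms bounded_clinear_op_minus_scalar[OF isometric_bounded_clinear]
  by (simp add: fredholm_def kernel_op_minus_scalar findim_zero closed_range_op_minus_scalar
      findim_kernel_adjoint_op_minus_scalar)

lemma fredholm_index_inside:
  assumes "cmod c < 1"
  shows "fredholm_index (op_minus_scalar W c) = - int (cdim (op_kernel (hilbert_adjoint W)))"
  \<comment> \<open>The empty set spans \<open>{0}\<close>, so the kernel of \<open>W - c\<close>
    contributes 0 to the index.\<close>
  using assms complex_vector.dim_le_card[of "{0}" "{}"]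
  by (simp add: fredholm_index_def kernel_op_minus_scalar cdim_kernel_adjoint_op_minus_scalar)

text \<open>Factoring out \<open>- c\<close> leaves \<open>I - inverse c W\<close>, which is
  bijective as \<open>inverse c\<close> lies in the disc. So \<open>W - c\<close> is surjective, and
  only 0 is orthogonal to its range.\<close>

lemma fredholm_outside:
  assumes "cmod c > 1"
  shows "fredholm (op_minus_scalar W c)"
proof -
  have c: "c \<noteq> 0" and c1: "cmod (inverse c) < 1"
    using assms by (auto simp: norm_inverse intro: inverse_less_1_iff[THEN iffD2])
  have "y \<in> range (op_minus_scalar W c)" for y
  proof -
    obtain x where x: "inverse c *\<^sub>C y = x - inverse c *\<^sub>C W x"
      using surjD[OF bij_is_surj[OF id_minus_scalar_bij[OF c1]]] by blast
    have "y = c *\<^sub>C inverse c *\<^sub>C y"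
      using c by (simp add: scaleC_scaleC)
    also have "\<dots> = op_minus_scalar W c (- x)"
      unfolding x using c
      by (simp add: op_minus_scalar_def complex_vector.scale_right_diff_distrib scaleC_scaleC
          linear_neg[OF isometric_linear])
    finally show ?thesis by blast
  qed
  then have surj: "range (op_minus_scalar W c) = UNIV"
    by blast
  note T = bounded_clinear_op_minus_scalar[OF isometric_bounded_clinear, of c]
  have "op_kernel (hilbert_adjoint (op_minus_scalar W c)) \<subseteq> {0}"
  proof
    fix y assume "y \<in> op_kernel (hilbert_adjoint (op_minus_scalar W c))"
    moreover obtain x where "y = op_minus_scalar W c x"
      using surj by blast
    ultimately show "y \<in> {0}"
      by (simp add: kernel_hilbert_adjoint[OF T]) (metis cinner_self_eq_zero)
  qed
  then have "findim (op_kernel (hilbert_adjoint (op_minus_scalar W c)))"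
    using findim_zero unfolding findim_def by blast
  then show ?thesis
    using assms T by (simp add: fredholm_def kernel_op_minus_scalar findim_zero surj)
qed

text \<open>In the expansion of the squared norm of \<open>W y - c y\<close>, both squares and both
  cross terms have the value \<open>cinner y y\<close>, so everything cancels.\<close>

lemma adjoint_eigenvector:
  assumes "cmod c = 1" and "hilbert_adjoint W y = cnj c *\<^sub>C y"
  shows "W y = c *\<^sub>C y"
proof -
  have cc: "c * cnj c = 1"
    using assms(1) by (simp flip: complex_norm_square)
  have 1: "cinner (W y) (c *\<^sub>C y) = cinner y y"
    using cc by (simp add: cinner_scaleC_right cinner_scaleC_left mult.assoc[symmetric]
        cinner_hilbert_adjoint[OF isometric_bounded_clinear] assms(2) mult.commute)
  then have 2: "cinner (c *\<^sub>C y) (W y) = cinner y y"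
    by (metis cinner_commute)
  have "cinner (W y - c *\<^sub>C y) (W y - c *\<^sub>C y) = 0"
    using cc by (simp add: cinner_diff_left cinner_diff_right 1 2 isometric_cinner,
        simp add: cinner_scaleC_left cinner_scaleC_right mult.assoc[symmetric] mult.commute[of _ c])
  then show ?thesis
    by (simp add: cinner_self_eq_zero)
qed

text \<open>A vector \<open>k\<close> of \<open>ker W\<^sup>*\<close> is orthogonal to \<open>ker (W - c)\<^sup>* = ker (W - c)\<close>, so if
  \<open>W - c\<close> has closed range, then \<open>k = W y - c y\<close> for some \<open>y\<close>. Applying \<open>W\<^sup>*\<close> gives
  \<open>W\<^sup>* y = cnj c y\<close>, that is \<open>y \<in> ker (W - c)\<^sup>*\<close>, whence \<open>k = 0\<close>.\<close>

lemma not_closed_range_on_circle: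
  assumes c: "cmod c = 1" and "\<not> unitary W"
  shows "\<not> closed (range (op_minus_scalar W c))"
proof
  note T = bounded_clinear_op_minus_scalar[OF isometric_bounded_clinear, of c]
  have cc: "c * cnj c = 1" "cnj c * c = 1"
    using c by (simp_all flip: complex_norm_square add: mult.commute)
  assume "closed (range (op_minus_scalar W c))"
  note decomp = orthogonal_decomposition[OF csubspace_range[OF T] this]
  obtain k where k: "k \<in> op_kernel (hilbert_adjoint W)" "k \<noteq> 0"
    using assms(2) unitary_if_kernel_adjoint_trivial by blast
  have kW: "cinner (W z) k = 0" for z
    using k(1) by (simp add: kernel_hilbert_adjoint[OF isometric_bounded_clinear])
  obtain p where p: "p \<in> range (op_minus_scalar W c)"
      "\<And>z. z \<in> range (op_minus_scalar W c) \<Longrightarrow> cinner z (k - p) = 0"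
    using decomp by metis
  have "k - p \<in> op_kernel (hilbert_adjoint (op_minus_scalar W c))"
    using p(2) by (simp add: kernel_hilbert_adjoint[OF T])
  then have eig: "W (k - p) = c *\<^sub>C (k - p)"
    using kernel_adjoint_op_minus_scalar[OF isometric_bounded_clinear] adjoint_eigenvector[OF c]
    by blast
  \<comment> \<open>By \<open>eig\<close>, the vector \<open>c (k - p)\<close> is a value of
    \<open>W\<close>, hence orthogonal to \<open>k\<close>.\<close>
  then have "c * cinner (k - p) k = 0"
    using kW[of "k - p"] by (simp add: cinner_scaleC_left)
  then have "cinner (k - p) k = 0"
    using c by auto
  moreover have "cinner (k - p) p = 0"
    using p cinner_eq_zero_swap by blast
  ultimately have "cinner (k - p) (k - p) = 0"
    by (simp add: cinner_diff_right)
  then have "k = p"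
    by (simp add: cinner_self_eq_zero)
  then obtain y where y: "k = W y - c *\<^sub>C y"
    using p(1) by (auto simp: op_minus_scalar_def)
  have "hilbert_adjoint W y = cnj c *\<^sub>C y"
  proof (rule cinner_left_eqI)
    fix z
    have "cinner z y = cnj c * cinner (W z) y"
      using kW[of z] by (simp add: y cinner_diff_right isometric_cinner cinner_scaleC_right)
    then have "c * cinner z y = cinner (W z) y"
      using cc(1) by (simp flip: mult.assoc)
    then show "cinner z (hilbert_adjoint W y) = cinner z (cnj c *\<^sub>C y)"
      by (simp add: cinner_scaleC_right cinner_hilbert_adjoint[OF isometric_bounded_clinear])
  qed
  then have "k = 0"
    using y adjoint_eigenvector[OF c] by simp
  with k(2) show False by simp
qed

lemma essential_spectrum_isometric:
  assumes "findim (op_kernel (hilbert_adjoint W))" and "\<not> unitary W"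
  shows "essential_spectrum W = sphere 0 1"
proof -
  have "fredholm (op_minus_scalar W c) \<longleftrightarrow> cmod c \<noteq> 1" for c
  proof (cases "cmod c" "1::real" rule: linorder_cases)
    case less
    then show ?thesis using fredholm_inside[OF _ assms(1)] by simp
  next
    case equal
    then show ?thesis using not_closed_range_on_circle[OF _ assms(2)] by (simp add: fredholm_def)
  next
    case greater
    then show ?thesis using fredholm_outside by simp
  qed
  then show ?thesis
    unfolding essential_spectrum_def by (simp add: set_eq_iff)
qed

end

section \<open>The odometer map\<close>

text \<open>The case distinction behind \<open>odometer_map\<close>: it is applied with the last
  letter to arguments of \<open>W\<close>, and with the first letter to coordinates of vectors in
  the kernel of the adjoint.\<close>

lemma word_cases:
  obtains k where "w = replicate k c"
  | k a v where "a \<noteq> c" "w = replicate k c @ [a] @ v"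
proof -
  have "(\<exists>k. w = replicate k c) \<or> (\<exists>k a v. a \<noteq> c \<and> w = replicate k c @ [a] @ v)"
  proof (induction w)
    case Nil
    show ?case by (simp add: exI[of _ 0])
  next
    case (Cons b w)
    show ?case
    proof (cases "b = c")
      case True
      then show ?thesis
        using Cons.IH by (metis append_Cons replicate_Suc)
    next
      case False
      then show ?thesis
        by (intro disjI2 exI[of _ 0]) auto
    qed
  qed
  then show thesis
    using that by blast
qed

section \<open>The alphabet and its successor map\<close>

lemma Rep_first_letter: "Rep_letter (first_letter :: 'n::finite letter) = 1"
  unfolding first_letter_def by (rule Abs_letter_inverse) (simp add: Suc_leI)

lemma Rep_last_letter: "Rep_letter (last_letter :: 'n::finite letter) = CARD('n)"
  unfolding last_letter_def by (rule Abs_letter_inverse) (simp add: Suc_leI)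

lemma Rep_next_letter:
  assumes "a \<noteq> (last_letter :: 'n::finite letter)"
  shows "Rep_letter (next_letter a) = Rep_letter a + 1"
proof -
  have "Rep_letter a \<noteq> CARD('n)"
    using assms Rep_last_letter by (metis Rep_letter_inject)
  then show ?thesis
    using Rep_letter[of a] unfolding next_letter_def by (intro Abs_letter_inverse) auto
qed

lemma next_letter_neq_first:
  assumes "a \<noteq> (last_letter :: 'n::finite letter)"
  shows "next_letter a \<noteq> first_letter"
  using Rep_next_letter[OF assms] Rep_letter[of a] Rep_first_letter[where ?'n = 'n] by auto

text \<open>The predecessor exists because the number of \<open>b\<close> exceeds 1. This puts every
  word that is not a power of the first letter within reach of the last clause of
  \<open>odometer_map\<close>.\<close>

lemma next_letter_surj:
  assumes "b \<noteq> (first_letter :: 'n::finite letter)"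
  obtains a where "a \<noteq> last_letter" "next_letter a = b"
proof -
  have "Rep_letter b \<noteq> 1"
    using assms Rep_first_letter by (metis Rep_letter_inject)
  then have b: "1 < Rep_letter b" "Rep_letter b \<le> CARD('n)"
    using Rep_letter[of b] by auto
  define a where "a = (Abs_letter (Rep_letter b - 1) :: 'n letter)"
  have a: "Rep_letter a = Rep_letter b - 1"
    unfolding a_def using b by (intro Abs_letter_inverse) auto
  then have "a \<noteq> last_letter"
    using b Rep_last_letter[where ?'n = 'n] by auto
  moreover have "next_letter a = b"
    unfolding next_letter_def a using b by (simp add: Rep_letter_inverse)
  ultimately show thesis
    by (rule that)
qed

section \<open>Coordinates in the Fock space\<close>

lemma cinner_word_tensor: "cinner (word_tensor w \<eta>) x = cinner \<eta> (Rep_ell2 x w)"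
proof transfer
  fix w :: "'a letter list" and \<eta> :: 'b and f :: "'a letter list \<Rightarrow> 'b"
  have "(\<Sum>\<^sub>\<infinity>i. cinner (if i = w then \<eta> else 0) (f i)) =
      (\<Sum>\<^sub>\<infinity>i\<in>{w}. cinner (if i = w then \<eta> else 0) (f i))"
    by (rule infsum_cong_neutral) auto
  then show "(\<Sum>\<^sub>\<infinity>i. cinner (if i = w then \<eta> else 0) (f i)) = cinner \<eta> (f w)"
    by simp
qed

lemma fock_coord_eq_0I:
  assumes "\<And>\<eta>. cinner (word_tensor w \<eta>) x = 0"
  shows "Rep_ell2 x w = 0"
  \<comment> \<open>The coordinate itself is the test vector.\<close>
  using assms[of "Rep_ell2 x w"] by (simp add: cinner_word_tensor cinner_self_eq_zero)

lemma fock_eq_0I: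
  assumes "\<And>w \<eta>. cinner (word_tensor w \<eta>) x = 0"
  shows "x = 0"
proof -
  have "Rep_ell2 x = (\<lambda>_. 0)"
    using fock_coord_eq_0I[OF assms] by auto
  then show ?thesis
    unfolding Rep_ell2_inject[symmetric] zero_ell2.rep_eq .
qed

text \<open>Let \<open>p\<close> be the projection of \<open>x\<close> onto the closed span. Then
  \<open>x - p\<close> vanishes at all words \<open>u m\<close> and \<open>x\<close> at all others,
  so \<open>x\<close> is orthogonal to \<open>x - p\<close>; since \<open>p\<close> is too,
  \<open>x = p\<close>.\<close>

lemma supported_in_closure_cspan:
  fixes x :: "('n::finite, 'e::complex_hilbert) fock"
  assumes supp: "\<And>w. w \<notin> range u \<Longrightarrow> Rep_ell2 x w = 0"
  shows "x \<in> closure (cspan {word_tensor (u m) \<eta> |m \<eta>. True})"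
proof -
  let ?A = "{word_tensor (u m) \<eta> |m \<eta>. True}"
  let ?M = "closure (cspan ?A)"
  have M: "complex_vector.subspace ?M"
    by (rule csubspace_closure[OF complex_vector.subspace_span])
  obtain p where p: "p \<in> ?M" "\<And>y. y \<in> ?M \<Longrightarrow> cinner y (x - p) = 0"
    by (rule orthogonal_decomposition[OF M closed_closure, of x]) (rule that)
  have "Rep_ell2 (x - p) (u m) = 0" for m
  proof (rule fock_coord_eq_0I)
    fix \<eta> :: 'e
    have "word_tensor (u m) \<eta> \<in> ?A"
      by blast
    then show "cinner (word_tensor (u m) \<eta>) (x - p) = 0"
      by (intro p(2) subsetD[OF closure_subset] complex_vector.span_base)
  qed
  then have "cinner (Rep_ell2 x w) (Rep_ell2 (x - p) w) = 0" for w
    using supp[of w] by (cases "w \<in> range u") auto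
  then have "cinner x (x - p) = 0"
    by (simp add: cinner_ell2.rep_eq)
  then have "cinner (x - p) (x - p) = 0"
    using p by (simp add: cinner_diff_left[of x p])
  then show ?thesis
    using p(1) by (simp add: cinner_self_eq_zero)
qed

text \<open>Orthogonality to the range is tested on the values prescribed by
  \<open>odometer_map\<close>: those involving \<open>next_letter\<close> force support on powers of
  the first letter, the others give orthogonality to the values of \<open>L\<close> and their
  shifts.\<close>

lemma kernel_adjoint_odometer:
  fixes L :: "'e::complex_hilbert \<Rightarrow> ('n::finite, 'e) fock"
  assumes "odometer_map L W"
  shows "op_kernel (hilbert_adjoint W) = odometer_space L \<ominus> range L"
proof (intro set_eqI iffI)
  have W: "bounded_clinear W"
    and W1: "\<And>\<eta>. W (word_tensor [] \<eta>) = L \<eta>"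
    and W2: "\<And>m \<eta>. m \<ge> 1 \<Longrightarrow> W (word_tensor (replicate m last_letter) \<eta>)
        = left_tensor (replicate m first_letter) (L \<eta>)"
    and W3: "\<And>k a \<nu> \<eta>. a \<noteq> last_letter \<Longrightarrow>
        W (word_tensor (replicate k last_letter @ [a] @ \<nu>) \<eta>)
          = word_tensor (replicate k first_letter @ [next_letter a] @ \<nu>) \<eta>"
    using assms unfolding odometer_map_def by auto
  fix x
  let ?A = "{word_tensor (replicate m first_letter) \<eta> |m \<eta>. True} :: ('n, 'e) fock set"
  {
    assume "x \<in> op_kernel (hilbert_adjoint W)"
    then have x: "cinner (W y) x = 0" for y
      by (simp add: kernel_hilbert_adjoint[OF W])
    have "x \<in> closure (cspan ?A)"
    proof (rule supported_in_closure_cspan)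
      fix w :: "'n letter list"
      assume "w \<notin> range (\<lambda>m. replicate m first_letter)"
      then obtain k b v where b: "b \<noteq> first_letter" "w = replicate k first_letter @ [b] @ v"
        by (cases w rule: word_cases[where c = first_letter]) auto
      \<comment> \<open>With this \<open>a\<close>, \<open>W3\<close> exhibits every elementary
        tensor at \<open>w\<close> as a value of \<open>W\<close>.\<close>
      then obtain a where "a \<noteq> last_letter" "next_letter a = b"
        using next_letter_surj by blast
      then show "Rep_ell2 x w = 0"
        unfolding b(2) by (intro fock_coord_eq_0I) (metis W3 x)
    qed
    \<comment> \<open>By \<open>W2\<close> the generators of this span are values of
      \<open>W\<close>.\<close>
    moreover have "cinner x y = 0"
      if "y \<in> closure (cspan {left_tensor (replicate p first_letter) (L \<zeta>) |p \<zeta>. p \<ge> 1})" for y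
      unfolding cinner_eq_zero_swap[of x y] using that
      by (rule orthogonal_closure_cspan[rotated]) (auto simp: x simp flip: W2)
    \<comment> \<open>The power 0, left out of the span removed in \<open>odometer_space\<close>, is
      supplied by \<open>range L\<close>.\<close>
    moreover have "cinner x (L \<eta>) = 0" for \<eta>
      using x[of "word_tensor [] \<eta>"] by (simp add: W1 cinner_eq_zero_swap[of x])
    ultimately show "x \<in> odometer_space L \<ominus> range L"
      by (simp add: odometer_space_def ortho_minus_def)
  next
    assume "x \<in> odometer_space L \<ominus> range L"
    then have xA: "x \<in> closure (cspan ?A)"
      and xL: "\<And>\<eta>. cinner x (L \<eta>) = 0"
      and xC: "\<And>y. y \<in> closure (cspan {left_tensor (replicate p first_letter) (L \<zeta>) |p \<zeta>. p \<ge> 1})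
        \<Longrightarrow> cinner x y = 0"
      by (auto simp: odometer_space_def ortho_minus_def)
    have xp: "cinner x (left_tensor (replicate p first_letter) (L \<zeta>)) = 0" if "p \<ge> 1" for p \<zeta>
      using that by (intro xC subsetD[OF closure_subset] complex_vector.span_base) blast
    \<comment> \<open>Elementary tensors suffice: \<open>fock_eq_0I\<close> then makes the adjoint
      of \<open>W\<close> vanish at \<open>x\<close>.\<close>
    have "cinner (W (word_tensor w \<eta>)) x = 0" for w \<eta>
    proof (cases w rule: word_cases[where c = last_letter])
      case (1 m)
      then show ?thesis
        using xL xp[of m] by (cases "m = 0") (simp_all add: W1 W2 cinner_eq_zero_swap[of _ x])
    next
      case (2 k a v)
      let ?w = "replicate k first_letter @ [next_letter a] @ v"
      \<comment> \<open>The word \<open>?w\<close> contains \<open>next_letter a\<close>, which is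
        not the first letter.\<close>
      have neq: "replicate m first_letter \<noteq> ?w" for m
        using next_letter_neq_first[OF 2(1)]
        by (metis append_Cons in_set_conv_decomp in_set_replicate)
      have "cinner y (word_tensor ?w \<eta>) = 0" if y: "y \<in> ?A" for y
      proof -
        obtain m \<zeta> where "y = word_tensor (replicate m first_letter) \<zeta>"
          using y by blast
        then show ?thesis
          using neq[of m] by (simp only: cinner_word_tensor word_tensor.rep_eq if_False cinner_zero_right)
      qed
      then have "cinner x (word_tensor ?w \<eta>) = 0"
        using xA by (rule orthogonal_closure_cspan)
      then show ?thesis
        unfolding 2(2) W3[OF 2(1)] by (rule cinner_eq_zero_swap[THEN iffD1])
    qed
    then have "hilbert_adjoint W x = 0"
      by (intro fock_eq_0I) (simp only: cinner_hilbert_adjoint[OF W])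
    then show "x \<in> op_kernel (hilbert_adjoint W)"
      by (simp add: op_kernel_def)
  }
qed

theorem theorem7p8:
  fixes L :: "'e::complex_hilbert \<Rightarrow> ('n::finite, 'e) fock"
    and W :: "('n, 'e) fock \<Rightarrow> ('n, 'e) fock"
  assumes "separable_space (euclidean :: 'e topology)"
    and "bounded_clinear L"
    and "odometer_map L W"
    and "isometric W"
    and "findim (odometer_space L \<ominus> range L)"
  shows "(\<forall>c. cmod c < 1 \<longrightarrow>
        fredholm (op_minus_scalar W c) \<and>
        fredholm_index (op_minus_scalar W c) = - int (cdim (op_kernel (hilbert_adjoint W))) \<and>
        - int (cdim (op_kernel (hilbert_adjoint W))) = - int (cdim (odometer_space L \<ominus> range L))) \<and>
    (\<not> unitary W \<longrightarrow> essential_spectrum W = sphere 0 1)"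
proof -
  \<comment> \<open>This equality of sets transfers the finiteness hypothesis to the kernel of the
    adjoint and equates the two dimensions.\<close>
  note ker = kernel_adjoint_odometer[OF assms(3)]
  have fin: "findim (op_kernel (hilbert_adjoint W))"
    unfolding ker by (rule assms(5))
  show ?thesis
  proof (intro conjI allI impI)
    fix c :: complex assume c: "cmod c < 1"
    show "fredholm (op_minus_scalar W c)"
      by (rule fredholm_inside[OF assms(4) c fin])
    show "fredholm_index (op_minus_scalar W c) = - int (cdim (op_kernel (hilbert_adjoint W)))"
      by (rule fredholm_index_inside[OF assms(4) c])
    show "- int (cdim (op_kernel (hilbert_adjoint W))) = - int (cdim (odometer_space L \<ominus> range L))"
      unfolding ker ..
  next
    assume "\<not> unitary W"
    then show "essential_spectrum W = sphere 0 1"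
      by (rule essential_spectrum_isometric[OF assms(4) fin])
  qed
qed

end
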